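(* Let $n\geq 2$, $f:\mathbb{R}^n\to(0,\infty)$, $g=-\log f$, and let $\xi:\mathbb{R}^n\to\mathbb{R}$ be $C^2$ in a neighbourhood of $0$ with $$\nabla\xi(0)=e_1,\qquad H_\xi(0)=\mathrm{diag}(0,2\pi,2\pi,\ldots,2\pi).$$ Let $y\in\mathbb{R}^n$, and let $T$ be an invertible $n\times n$ real matrix such that for all $x\in\mathbb{R}^n$, $$\frac{f(y+Tx)}{f(y)}=\exp(-\xi(x)).$$ Then $T$ can be expressed as $$T=A^{-1/2}F^{T},$$ where $A$ is the $n\times n$ matrix defined by $$A_{ij}=\frac{1}{2\pi}\partial_{ij}g(y)+\partial_ig(y)\,\partial_jg(y),$$ which is positive definite, $A^{-1/2}$ is the principal square root of $A^{-1}$, and $F\in O(n)$ is such that $$FA^{-1/2}\nabla g(y)=e_1.$$ This also implies that $$Te_1=A^{-1}\nabla g(y).$$ Furthermore, in the special case where $\xi(x)=x_1+\pi\sum_{i=2}^{n}x_i^2$, for any $G\in O(n)$ such that $$GA^{-1/2}\nabla g(y)=e_1,$$ it follows that for all $x\in\mathbb{R}^n$, $$\frac{f(y+A^{-1/2}G^{T}x)}{f(y)}=\exp\left(-x_1-\pi\sum_{i=2}^{n}x_i^2\right).$$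
   Context: $e_1$ is the first standard basis vector of $\mathbb{R}^n$, $H_\xi(0)$ is the Hessian matrix of $\xi$ at $0$, $O(n)$ is the group of orthogonal $n\times n$ matrices, and the superscript $T$ in $F^{T}$, $G^{T}$ denotes transpose. *)

theory Defs
  imports "HOL-Analysis.Analysis"
begin

definition partial_deriv :: "'n::finite \<Rightarrow> (real^'n \<Rightarrow> real) \<Rightarrow> real^'n \<Rightarrow> real" where
  "partial_deriv i f x = deriv (\<lambda>t. f (x + t *\<^sub>R axis i 1)) 0"

definition gradient :: "(real^'n::finite \<Rightarrow> real) \<Rightarrow> real^'n \<Rightarrow> real^'n" where
  "gradient f x = (\<chi> i. partial_deriv i f x)"

definition hessian :: "(real^'n::finite \<Rightarrow> real) \<Rightarrow> real^'n \<Rightarrow> real^'n^'n" where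
  "hessian f x = (\<chi> i j. partial_deriv i (partial_deriv j f) x)"

(* Intended for open U. Since deriv is total, existence of the partial derivatives
   has to be required separately. *)
primrec Ck_on :: "nat \<Rightarrow> (real^'n::finite) set \<Rightarrow> (real^'n \<Rightarrow> real) \<Rightarrow> bool" where
  "Ck_on 0 U f \<longleftrightarrow> continuous_on U f"
| "Ck_on (Suc k) U f \<longleftrightarrow> continuous_on U f \<and>
     (\<forall>i. (\<forall>x\<in>U. (\<lambda>t. f (x + t *\<^sub>R axis i 1)) field_differentiable (at 0)) \<and>
          Ck_on k U (partial_deriv i f))"

definition Ck_near :: "nat \<Rightarrow> real^'n::finite \<Rightarrow> (real^'n \<Rightarrow> real) \<Rightarrow> bool" where
  "Ck_near k x f \<longleftrightarrow> (\<exists>U. open U \<and> x \<in> U \<and> Ck_on k U f)"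

definition diag_matrix :: "real^'n::finite \<Rightarrow> real^'n^'n" where
  "diag_matrix d = (\<chi> i j. if i = j then d $ i else 0)"

definition positive_definite :: "real^'n::finite^'n \<Rightarrow> bool" where
  "positive_definite A \<longleftrightarrow> transpose A = A \<and> (\<forall>x. x \<noteq> 0 \<longrightarrow> 0 < x \<bullet> (A *v x))"

definition positive_semidefinite :: "real^'n::finite^'n \<Rightarrow> bool" where
  "positive_semidefinite A \<longleftrightarrow> transpose A = A \<and> (\<forall>x. 0 \<le> x \<bullet> (A *v x))"

(* Meaningful for positive semidefinite A, which has exactly one positive
   semidefinite square root. *)
definition principal_sqrt :: "real^'n::finite^'n \<Rightarrow> real^'n^'n" where
  "principal_sqrt A = (THE S. positive_semidefinite S \<and> S ** S = A)"

end

theory Submission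
  imports Defs
begin

text \<open>With \<open>S = T\<^sup>-\<^sup>1\<close> the hypothesis reads \<open>g z = g y + \<xi> (S (z - y))\<close>, so the chain rule gives
  \<open>\<nabla>g(y) = S\<^sup>T e\<^sub>1\<close> and \<open>H\<^sub>g(y) = S\<^sup>T H\<^sub>\<xi>(0) S\<close>; since \<open>H\<^sub>\<xi>(0) / 2\<pi> + e\<^sub>1 e\<^sub>1\<^sup>T\<close> is the identity,
  \<open>A = S\<^sup>T S\<close> and \<open>A\<^sup>-\<^sup>1 = T T\<^sup>T\<close>. The principal square root of \<open>T T\<^sup>T\<close> is the positive semidefinite factor
  \<open>T F\<close> of the polar decomposition, obtained by maximising \<open>tr (T Q)\<close> over orthogonal \<open>Q\<close>; this needs no
  spectral theorem. For any other admissible \<open>G\<close>, the orthogonal matrix \<open>F G\<^sup>T\<close> fixes \<open>e\<^sub>1\<close>, hence it preserves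
  \<open>x\<^sub>1 + \<pi> (x\<^sub>2\<^sup>2 + \<dots> + x\<^sub>n\<^sup>2)\<close>.\<close>

section \<open>Derivatives from partial derivatives\<close>

text \<open>\<open>Ck_on\<close> speaks of partial derivatives only; this is the bridge to the total
  derivative. The increment is made one coordinate at a time, the mean value theorem handles each
  segment, and continuity of the partial derivatives at \<open>x\<close> bounds the error.\<close>

lemma has_derivative_gradient:
  fixes f :: "real^'n::finite \<Rightarrow> real"
  assumes U: "open U" "x \<in> U" and C1: "Ck_on (Suc m) U f"
  shows "(f has_derivative (\<lambda>h. h \<bullet> gradient f x)) (at x)"
proof -
  have cont: "continuous_on U (partial_deriv i f)" for i
    using C1 by (cases m) auto
  have diff: "(\<lambda>t. f (z + t *\<^sub>R axis i 1)) field_differentiable (at 0)" if "z \<in> U" for z i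
    using C1 that by auto
  \<comment> \<open>\<open>partial_deriv\<close> differentiates at parameter 0; a shift of the
    parameter gives the derivative at every point of the line that lies in \<open>U\<close>.\<close>
  have line: "((\<lambda>t. f (w + t *\<^sub>R axis i 1)) has_real_derivative partial_deriv i f (w + t *\<^sub>R axis i 1)) (at t)"
    if "w + t *\<^sub>R axis i 1 \<in> U" for w t i
  proof -
    let ?z = "w + t *\<^sub>R axis i 1 :: real^'n"
    have "((\<lambda>s. f (?z + s *\<^sub>R axis i 1)) has_real_derivative partial_deriv i f ?z) (at 0)"
      unfolding partial_deriv_def using diff[OF that] DERIV_deriv_iff_field_differentiable by blast
    then have "((\<lambda>s. f (?z + (s - t) *\<^sub>R axis i 1)) has_real_derivative partial_deriv i f ?z) (at t)"
      using DERIV_shift[of "\<lambda>s. f (?z + s *\<^sub>R axis i 1)" _ t "- t"] by simp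
    then show ?thesis by (simp add: algebra_simps)
  qed
  show ?thesis
    unfolding has_derivative_at_alt
  proof (intro conjI allI impI)
    show "bounded_linear (\<lambda>h. h \<bullet> gradient f x)" by (rule bounded_linear_inner_left)
    fix e :: real assume "e > 0"
    \<comment> \<open>Each of the \<open>CARD('n)\<close> coordinate steps may cost
      \<open>c * norm h\<close>, which adds up to \<open>e * norm h\<close>.\<close>
    define c where "c = e / CARD('n)"
    have "c > 0" using \<open>e > 0\<close> by (simp add: c_def)
    have "\<forall>\<^sub>F z in at x. \<forall>i. dist (partial_deriv i f z) (partial_deriv i f x) < c"
      using cont U \<open>c > 0\<close>
      by (intro eventually_all_finite tendstoD)
         (auto simp: continuous_on_eq_continuous_at continuous_at)
    moreover have "\<forall>\<^sub>F z in at x. z \<in> U"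
      using U by (simp add: eventually_at_topological) blast
    ultimately have "\<forall>\<^sub>F z in at x. z \<in> U \<and> (\<forall>i. dist (partial_deriv i f z) (partial_deriv i f x) < c)"
      by eventually_elim auto
    then obtain d where "d > 0" and d0: "\<And>z. z \<noteq> x \<Longrightarrow> dist z x < d \<Longrightarrow>
        z \<in> U \<and> (\<forall>i. dist (partial_deriv i f z) (partial_deriv i f x) < c)"
      unfolding eventually_at by auto
    have d: "z \<in> U" "\<bar>partial_deriv i f z - partial_deriv i f x\<bar> \<le> c" if "norm (z - x) < d" for z i
      using d0[of z] that U \<open>c > 0\<close>
      by (cases "z = x"; simp add: dist_norm less_imp_le)+
    show "\<exists>d>0. \<forall>z. norm (z - x) < d \<longrightarrow> norm (f z - f x - (z - x) \<bullet> gradient f x) \<le> e * norm (z - x)"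
    proof (intro exI conjI allI impI)
      fix z assume z: "norm (z - x) < d"
      define h where "h = z - x"
      \<comment> \<open>\<open>H J\<close> keeps the coordinates of \<open>h\<close> in
        \<open>J\<close>, so it leads from 0 at \<open>J = {}\<close> to \<open>h\<close> at
        \<open>J = UNIV\<close>.\<close>
      define H where "H J = (\<chi> i. if i \<in> J then h $ i else 0)" for J
      have step: "\<bar>f (x + H J) - f x - (\<Sum>i\<in>J. h $ i * partial_deriv i f x)\<bar> \<le> c * (\<Sum>i\<in>J. \<bar>h $ i\<bar>)" for J
      proof (induction J rule: finite_induct[OF finite])
        case 1
        have "H {} = 0" by (simp add: H_def vec_eq_iff)
        then show ?case by simp
      next
        case (2 j J)
        have Hins: "H (insert j J) = H J + (h $ j) *\<^sub>R axis j 1"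
          using 2 by (auto simp: H_def vec_eq_iff axis_def)
        \<comment> \<open>Every coordinate of the displacement is at most that of \<open>h\<close>
          in absolute value, so the whole segment stays in the ball.\<close>
        have near: "norm (x + H J + t *\<^sub>R axis j 1 - x) < d" if "\<bar>t\<bar> \<le> \<bar>h $ j\<bar>" for t
        proof -
          have "norm (H J + t *\<^sub>R axis j 1) \<le> norm h"
            unfolding norm_vec_def using that 2(2) by (intro L2_set_mono) (auto simp: H_def axis_def)
          then show ?thesis using z by (simp add: h_def add.assoc)
        qed
        \<comment> \<open>The mean value theorem needs ordered endpoints, hence the split by the
          sign of \<open>h $ j\<close>.\<close>
        have "\<exists>t. \<bar>t\<bar> \<le> \<bar>h $ j\<bar> \<and> f (x + H J + (h $ j) *\<^sub>R axis j 1) - f (x + H J)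
                = h $ j * partial_deriv j f (x + H J + t *\<^sub>R axis j 1)"
        proof -
          consider "h $ j = 0" | "h $ j > 0" | "h $ j < 0" by linarith
          then show ?thesis
          proof cases
            case 1 then show ?thesis by (intro exI[of _ 0]) auto
          next
            case a: 2
            have "\<exists>t. 0 < t \<and> t < h $ j \<and> f (x + H J + (h $ j) *\<^sub>R axis j 1) - f (x + H J + 0 *\<^sub>R axis j 1)
                = (h $ j - 0) * partial_deriv j f (x + H J + t *\<^sub>R axis j 1)"
              using a by (intro MVT2[where f="\<lambda>t. f (x + H J + t *\<^sub>R axis j 1)"] line d near) auto
            then obtain t where "0 < t" "t < h $ j" "f (x + H J + (h $ j) *\<^sub>R axis j 1) - f (x + H J)
                = h $ j * partial_deriv j f (x + H J + t *\<^sub>R axis j 1)" by auto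
            then show ?thesis by (intro exI[of _ t]) auto
          next
            case a: 3
            have "\<exists>t. h $ j < t \<and> t < 0 \<and> f (x + H J + 0 *\<^sub>R axis j 1) - f (x + H J + (h $ j) *\<^sub>R axis j 1)
                = (0 - h $ j) * partial_deriv j f (x + H J + t *\<^sub>R axis j 1)"
              using a by (intro MVT2[where f="\<lambda>t. f (x + H J + t *\<^sub>R axis j 1)"] line d near) auto
            then obtain t where "h $ j < t" "t < 0" "f (x + H J) - f (x + H J + (h $ j) *\<^sub>R axis j 1)
                = - (h $ j * partial_deriv j f (x + H J + t *\<^sub>R axis j 1))" by auto
            then show ?thesis by (intro exI[of _ t]) auto
          qed
        qed
        then obtain t where t: "\<bar>t\<bar> \<le> \<bar>h $ j\<bar>"
          and eq: "f (x + H J + (h $ j) *\<^sub>R axis j 1) - f (x + H J)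
                = h $ j * partial_deriv j f (x + H J + t *\<^sub>R axis j 1)" by blast
        have "\<bar>h $ j * (partial_deriv j f (x + H J + t *\<^sub>R axis j 1) - partial_deriv j f x)\<bar> \<le> \<bar>h $ j\<bar> * c"
          unfolding abs_mult by (intro mult_left_mono d near t) auto
        with 2(3) eq show ?case
          unfolding Hins sum.insert[OF 2(1,2)] by (simp add: algebra_simps)
      qed
      have "H UNIV = h" by (simp add: H_def vec_eq_iff)
      moreover have "(\<Sum>i\<in>UNIV. h $ i * partial_deriv i f x) = h \<bullet> gradient f x"
        by (simp add: inner_vec_def gradient_def)
      ultimately have "\<bar>f z - f x - h \<bullet> gradient f x\<bar> \<le> c * (\<Sum>i\<in>UNIV. \<bar>h $ i\<bar>)"
        using step[of UNIV] by (simp add: h_def)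
      also have "\<dots> \<le> c * (\<Sum>i\<in>(UNIV::'n set). norm h)"
        using \<open>c > 0\<close> by (intro mult_left_mono sum_mono component_le_norm_cart) auto
      also have "\<dots> = e * norm h" by (simp add: c_def)
      finally show "norm (f z - f x - (z - x) \<bullet> gradient f x) \<le> e * norm (z - x)"
        by (simp add: h_def)
    qed (fact \<open>d > 0\<close>)
  qed
qed

section \<open>Chain rule under an affine substitution\<close>

lemma partial_deriv_eq_has_derivative:
  assumes "(f has_derivative D) (at x)"
  shows "partial_deriv i f x = D (axis i 1)"
proof -
  have "((\<lambda>t. x + t *\<^sub>R axis i 1) has_derivative (\<lambda>t. t *\<^sub>R axis i 1)) (at (0::real))"
    by (auto intro!: derivative_eq_intros)
  moreover have "(f has_derivative D) (at (x + 0 *\<^sub>R axis i 1))" using assms by simp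
  ultimately have "((\<lambda>t. f (x + t *\<^sub>R axis i 1)) has_derivative (\<lambda>t. D (t *\<^sub>R axis i 1))) (at 0)"
    by (rule has_derivative_compose)
  moreover have "(\<lambda>t. D (t *\<^sub>R axis i 1)) = (*) (D (axis i 1))"
    using assms by (auto simp: linear_simps has_derivative_bounded_linear linear_scale bounded_linear.linear)
  ultimately show ?thesis
    unfolding partial_deriv_def by (intro DERIV_imp_deriv) (simp add: has_field_derivative_def)
qed

lemma inner_matrix_vector_transpose:
  fixes A :: "real^'n::finite^'m::finite"
  shows "x \<bullet> (A *v y) = (transpose A *v x) \<bullet> y"
  by (simp add: dot_lmul_matrix)

lemma has_derivative_affine:
  fixes S :: "real^'n::finite^'m::finite"
  assumes "(\<phi> has_derivative (\<lambda>h. h \<bullet> v)) (at (b + S *v z))"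
  shows "((\<lambda>z. c + \<phi> (b + S *v z)) has_derivative (\<lambda>h. h \<bullet> (transpose S *v v))) (at z)"
proof -
  have "((\<lambda>z. b + S *v z) has_derivative (\<lambda>h. S *v h)) (at z)"
    by (intro has_derivative_eq_rhs[OF has_derivative_add[OF has_derivative_const
          bounded_linear_imp_has_derivative]]) auto
  from has_derivative_compose[OF this assms]
  have "((\<lambda>z. c + \<phi> (b + S *v z)) has_derivative (\<lambda>h. 0 + (S *v h) \<bullet> v)) (at z)"
    by (intro has_derivative_add has_derivative_const)
  moreover have "(S *v h) \<bullet> v = h \<bullet> (transpose S *v v)" for h
    using inner_matrix_vector_transpose[of v S h] by (simp only: inner_commute)
  ultimately show ?thesis by simp
qed

text \<open>The first partial derivatives of the composite are fixed linear combinations of those of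
  \<phi> at the affine image point, so the same chain rule, applied to each partial derivative of
  \<phi>, yields the second ones.\<close>

lemma
  fixes S :: "real^'n::finite^'m::finite"
  assumes C2: "Ck_near 2 (b + S *v y) \<phi>"
  shows gradient_affine: "gradient (\<lambda>z. c + \<phi> (b + S *v z)) y = transpose S *v gradient \<phi> (b + S *v y)"
    and hessian_affine: "hessian (\<lambda>z. c + \<phi> (b + S *v z)) y = transpose S ** hessian \<phi> (b + S *v y) ** S"
proof -
  let ?g = "\<lambda>z. c + \<phi> (b + S *v z)" and ?x = "b + S *v y"
  obtain U where U: "open U" "?x \<in> U" and Ck: "Ck_on (Suc (Suc 0)) U \<phi>"
    using C2 by (auto simp: Ck_near_def numeral_2_eq_2)
  have partial: "partial_deriv j ?g z = axis j 1 \<bullet> (transpose S *v gradient \<phi> (b + S *v z))"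
    if "b + S *v z \<in> U" for z j
    by (intro partial_deriv_eq_has_derivative has_derivative_affine has_derivative_gradient[OF U(1) that Ck])
  then show "gradient ?g y = transpose S *v gradient \<phi> ?x"
    using U(2) by (simp add: gradient_def vec_eq_iff inner_axis' inner_axis)
  have dot: "axis j 1 \<bullet> (transpose S *v v) = (\<Sum>l\<in>UNIV. S $ l $ j * v $ l)" for j v
    by (simp add: inner_axis' matrix_vector_mult_def transpose_def del: transpose_matrix_vector)
  have V: "open ((\<lambda>z. b + S *v z) -` U)"
    by (intro open_vimage U continuous_intros)
  have "hessian ?g y $ i $ j = (transpose S ** hessian \<phi> ?x ** S) $ i $ j" for i j
  proof -
    have "(partial_deriv l \<phi> has_derivative (\<lambda>h. h \<bullet> gradient (partial_deriv l \<phi>) ?x)) (at ?x)" for l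
      using has_derivative_gradient[OF U, of 0] Ck by auto
    from has_derivative_affine[OF this, where c=0]
    have "((\<lambda>z. \<Sum>l\<in>UNIV. S $ l $ j * partial_deriv l \<phi> (b + S *v z)) has_derivative
       (\<lambda>h. \<Sum>l\<in>UNIV. S $ l $ j * (h \<bullet> (transpose S *v gradient (partial_deriv l \<phi>) ?x)))) (at y)"
      by (intro has_derivative_sum has_derivative_mult_right) simp
    moreover have "(\<Sum>l\<in>UNIV. S $ l $ j * partial_deriv l \<phi> (b + S *v z)) = partial_deriv j ?g z"
      if "z \<in> (\<lambda>z. b + S *v z) -` U" for z
      using that by (simp only: partial dot vimage_eq) (simp add: gradient_def)
    \<comment> \<open>The formula for \<open>partial_deriv j ?g\<close> is known only on the
      preimage of \<open>U\<close>; this set is open, which is enough to differentiate at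
      \<open>y\<close>.\<close>
    ultimately have "(partial_deriv j ?g has_derivative
       (\<lambda>h. \<Sum>l\<in>UNIV. S $ l $ j * (h \<bullet> (transpose S *v gradient (partial_deriv l \<phi>) ?x)))) (at y)"
      using U(2) V by (elim has_derivative_transform_within_open) auto
    from partial_deriv_eq_has_derivative[OF this, of i]
    have "hessian ?g y $ i $ j = (\<Sum>l\<in>UNIV. S $ l $ j * (\<Sum>m\<in>UNIV. S $ m $ i * hessian \<phi> ?x $ m $ l))"
      by (simp only: dot) (simp add: hessian_def gradient_def)
    then show ?thesis
      by (simp add: matrix_matrix_mult_def transpose_def mult.commute)
  qed
  then show "hessian ?g y = transpose S ** hessian \<phi> ?x ** S"
    by (simp add: vec_eq_iff)
qed

section \<open>Positive semidefinite square roots\<close>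

text \<open>The quadratic has a minimum at \<open>t = 0\<close>, so its derivative there vanishes.
  This serves as the first-order condition in the variational arguments below.\<close>

lemma linear_coeff_eq_0:
  fixes a b :: real
  assumes "\<And>t. 0 \<le> t * a + t\<^sup>2 * b"
  shows "a = 0"
proof (rule ccontr)
  assume "a \<noteq> 0"
  define c where "c = \<bar>b\<bar> + 1"
  have "c > 0" "b < c" by (auto simp: c_def)
  \<comment> \<open>Since \<open>c\<close> is positive and exceeds \<open>b\<close>, this
    \<open>t\<close> makes the quadratic term too small to compensate the negative linear
    one.\<close>
  define t where "t = - a / c"
  have "t * a + t\<^sup>2 * b = (a / c)\<^sup>2 * (b - c)"
    using \<open>c > 0\<close> by (simp add: t_def power2_eq_square field_simps)
  moreover have "\<dots> < 0"
    using \<open>a \<noteq> 0\<close> \<open>c > 0\<close> \<open>b < c\<close> by (intro mult_pos_neg) auto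
  ultimately show False using assms[of t] by linarith
qed

text \<open>Along \<open>x + t *\<^sub>R (S *v x)\<close> the quadratic form is nonnegative and
  vanishes at \<open>t = 0\<close>; its linear coefficient is twice the squared norm of
  \<open>S *v x\<close>.\<close>

lemma positive_semidefinite_null:
  assumes S: "positive_semidefinite S" and x: "x \<bullet> (S *v x) = 0"
  shows "S *v x = 0"
proof -
  let ?w = "S *v x"
  have sym: "x \<bullet> (S *v ?w) = ?w \<bullet> ?w"
    using S by (simp add: positive_semidefinite_def inner_matrix_vector_transpose)
  have "0 \<le> t * (2 * (?w \<bullet> ?w)) + t\<^sup>2 * (?w \<bullet> (S *v ?w))" for t
  proof -
    have "0 \<le> (x + t *\<^sub>R ?w) \<bullet> (S *v (x + t *\<^sub>R ?w))"
      using S by (simp add: positive_semidefinite_def)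
    also have "\<dots> = t * (2 * (?w \<bullet> ?w)) + t\<^sup>2 * (?w \<bullet> (S *v ?w))"
      using x sym by (simp add: matrix_vector_right_distrib matrix_vector_mult_scaleR inner_add_left inner_add_right
          power2_eq_square algebra_simps)
    finally show ?thesis .
  qed
  from linear_coeff_eq_0[OF this] show ?thesis by simp
qed

text \<open>Symmetry moves the left factor \<open>D\<close> across the inner product. For positive
  semidefinite \<open>S\<close> every summand is nonnegative.\<close>

lemma trace_conj_eq_sum:
  fixes D S :: "real^'n::finite^'n"
  assumes "transpose D = D"
  shows "trace (D ** S ** D) = (\<Sum>i\<in>UNIV. (D *v axis i 1) \<bullet> (S *v (D *v axis i 1)))"
proof -
  have "(D ** S ** D) $ i $ i = axis i 1 \<bullet> ((D ** S ** D) *v axis i 1)" for i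
    by (simp add: inner_axis' matrix_vector_mult_basis column_def)
  also have "\<dots> i = (D *v axis i 1) \<bullet> (S *v (D *v axis i 1))" for i
    using assms by (simp add: inner_matrix_vector_transpose flip: matrix_vector_mul_assoc)
  finally show ?thesis by (simp add: trace_def)
qed

text \<open>With \<open>D = S - P\<close>, the equation \<open>S\<^sup>2 = P\<^sup>2\<close> reads \<open>SD + DP = 0\<close>; multiplying by \<open>D\<close> and taking
  traces, \<open>tr (DSD) + tr (DPD) = 0\<close>, a sum of nonnegative terms.\<close>
lemma positive_semidefinite_sqrt_unique:
  fixes S P :: "real^'n::finite^'n"
  assumes S: "positive_semidefinite S" and P: "positive_semidefinite P" and eq: "S ** S = P ** P"
  shows "S = P"
proof -
  define D where "D = S - P"
  have symD: "transpose D = D"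
    using S P by (simp add: D_def positive_semidefinite_def transpose_def vec_eq_iff)
  have "S *v (S *v x) = P *v (P *v x)" for x
    using eq by (simp add: matrix_vector_mul_assoc)
  then have "D ** S ** D + D ** D ** P = mat 0"
    by (simp add: matrix_eq D_def algebra_simps flip: matrix_vector_mul_assoc)
  then have "trace (D ** S ** D) + trace (D ** D ** P) = 0"
    by (metis trace_add trace_0)
  moreover have "trace (D ** D ** P) = trace (D ** P ** D)"
    by (metis matrix_mul_assoc trace_mul_sym)
  ultimately have "(\<Sum>i\<in>UNIV. (D *v axis i 1) \<bullet> (S *v (D *v axis i 1)) + (D *v axis i 1) \<bullet> (P *v (D *v axis i 1))) = 0"
    by (simp add: trace_conj_eq_sum[OF symD] sum.distrib)
  moreover have nonneg: "0 \<le> z \<bullet> (S *v z)" "0 \<le> z \<bullet> (P *v z)" for z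
    using S P by (auto simp: positive_semidefinite_def)
  ultimately have "(D *v axis i 1) \<bullet> (S *v (D *v axis i 1)) + (D *v axis i 1) \<bullet> (P *v (D *v axis i 1)) = 0" for i
    by (subst (asm) sum_nonneg_eq_0_iff) auto
  then have "(D *v axis i 1) \<bullet> (S *v (D *v axis i 1)) = 0" "(D *v axis i 1) \<bullet> (P *v (D *v axis i 1)) = 0" for i
    using nonneg[of "D *v axis i 1"] by (smt (verit))+
  then have "S *v (D *v axis i 1) = 0" "P *v (D *v axis i 1) = 0" for i
    using S P positive_semidefinite_null by blast+
  \<comment> \<open>\<open>S\<close> and \<open>P\<close> both annihilate the columns of
    \<open>D\<close>, hence so does their difference \<open>D\<close>. By symmetry each column of
    \<open>D\<close> then has norm 0.\<close>
  then have "D *v (D *v axis i 1) = 0" for i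
    by (simp add: D_def matrix_vector_mult_diff_rdistrib)
  then have "D *v axis i 1 = 0" for i
    using inner_matrix_vector_transpose[of "D *v axis i 1" D "axis i 1"] symD by simp
  then have "D $ j $ i = 0" for i j
    by (metis matrix_vector_mult_basis column_def vec_lambda_beta zero_index)
  then have "D = 0" by (simp add: vec_eq_iff)
  then show ?thesis by (simp add: D_def)
qed

lemma principal_sqrt_eqI:
  assumes "positive_semidefinite S" "S ** S = A"
  shows "principal_sqrt A = S"
  unfolding principal_sqrt_def using assms positive_semidefinite_sqrt_unique by blast

section \<open>Polar decomposition\<close>

definition outer_product :: "real^'n::finite \<Rightarrow> real^'m::finite \<Rightarrow> real^'m^'n" where
  "outer_product u v = (\<chi> i j. u $ i * v $ j)"

lemma outer_product_vector: "outer_product u v *v x = (v \<bullet> x) *\<^sub>R u"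
  by (simp add: outer_product_def vec_eq_iff matrix_vector_mult_def inner_vec_def sum_distrib_left mult_ac)

lemma trace_outer_product: "trace (M ** outer_product u v) = v \<bullet> (M *v u)"
  by (simp add: trace_def outer_product_def matrix_matrix_mult_def matrix_vector_mult_def inner_vec_def
      sum_distrib_left mult_ac)

section \<open>Householder reflections and trace maximality\<close>

definition householder :: "real^'n::finite \<Rightarrow> real^'n^'n" where
  "householder u = mat 1 - (2 / (u \<bullet> u)) *\<^sub>R outer_product u u"

lemma householder_vector: "householder u *v x = x - (2 * (u \<bullet> x) / (u \<bullet> u)) *\<^sub>R u"
  by (simp add: householder_def matrix_vector_mult_diff_rdistrib outer_product_vector flip: scaleR_matrix_vector_assoc)

lemma orthogonal_householder:
  assumes "u \<noteq> 0"
  shows "orthogonal_matrix (householder u)"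
proof -
  have "transpose (householder u) = householder u"
    by (simp add: householder_def outer_product_def transpose_def mat_def vec_eq_iff mult.commute)
  moreover have "householder u *v (householder u *v x) = x" for x
  proof -
    have "u \<bullet> (householder u *v x) = - (u \<bullet> x)"
      using assms by (simp add: householder_vector inner_diff_right)
    then show ?thesis
      by (simp add: householder_vector[of u "householder u *v x"]) (simp add: householder_vector)
  qed
  ultimately show ?thesis
    by (simp add: orthogonal_matrix matrix_eq flip: matrix_vector_mul_assoc)
qed

lemma matrix_mult_diff_scaleR_rdistrib:
  fixes M N P :: "real^'n::finite^'n"
  shows "M ** (N - c *\<^sub>R P) = M ** N - c *\<^sub>R (M ** P)"
  by (simp add: matrix_eq matrix_vector_mult_diff_rdistrib matrix_vector_mult_diff_distrib
      matrix_vector_mult_scaleR flip: matrix_vector_mul_assoc scaleR_matrix_vector_assoc)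

lemma trace_scaleR: "trace (c *\<^sub>R (N :: real^'n::finite^'n)) = c * trace N"
  by (simp add: trace_def sum_distrib_left)

text \<open>The change of the trace is a Rayleigh quotient of \<open>M\<close>, which turns
  maximality of the trace into inequalities for the quadratic form.\<close>

lemma trace_mult_householder:
  "trace (M ** householder u) = trace M - 2 * (u \<bullet> (M *v u)) / (u \<bullet> u)"
  by (simp add: householder_def matrix_mult_diff_scaleR_rdistrib trace_sub trace_scaleR trace_outer_product)

text \<open>Testing maximality against one reflection gives nonnegativity, and testing it against a product
  of two reflections in nearly equal vectors \<open>u\<close> and \<open>u + t w\<close> gives symmetry to first order in \<open>t\<close>.\<close>
lemma positive_semidefinite_if_trace_max:
  fixes M :: "real^'n::finite^'n"
  assumes max: "\<And>R. orthogonal_matrix R \<Longrightarrow> trace (M ** R) \<le> trace M"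
  shows "positive_semidefinite M"
proof -
  have "0 \<le> u \<bullet> (M *v u)" for u
  proof (cases "u = 0")
    case False
    then have "0 \<le> 2 * (u \<bullet> (M *v u)) / (u \<bullet> u)"
      using max[OF orthogonal_householder[OF False]] by (simp add: trace_mult_householder)
    moreover have "0 < u \<bullet> u" using False by simp
    ultimately show ?thesis by (simp add: zero_le_divide_iff del: inner_gt_zero_iff)
  qed auto
  \<comment> \<open>Maximality is tested at \<open>householder u ** householder v\<close>; the trace
    formula is used twice and the positive denominators are cleared.\<close>
  moreover have two: "2 * (u \<bullet> v) * (v \<bullet> (M *v u)) \<le> (u \<bullet> (M *v u)) * (v \<bullet> v) + (v \<bullet> (M *v v)) * (u \<bullet> u)" for u v
  proof (cases "u = 0 \<or> v = 0")
    case False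
    then have pos: "u \<bullet> u > 0" "v \<bullet> v > 0" by auto
    have "trace (M ** (householder u ** householder v)) \<le> trace M"
      using False by (intro max orthogonal_matrix_mul orthogonal_householder) auto
    then have "trace (M ** householder u) - 2 * (v \<bullet> (M *v (householder u *v v))) / (v \<bullet> v) \<le> trace M"
      by (simp add: matrix_mul_assoc trace_mult_householder matrix_vector_mul_assoc)
    then have "0 \<le> 2 * (u \<bullet> (M *v u)) / (u \<bullet> u) + 2 * (v \<bullet> (M *v v)) / (v \<bullet> v)
        - 4 * (u \<bullet> v) * (v \<bullet> (M *v u)) / ((u \<bullet> u) * (v \<bullet> v))"
      by (simp add: trace_mult_householder householder_vector matrix_vector_mult_diff_distrib
          matrix_vector_mult_scaleR inner_diff_right diff_divide_distrib algebra_simps)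
    also have "\<dots> = 2 * ((u \<bullet> (M *v u)) * (v \<bullet> v) + (v \<bullet> (M *v v)) * (u \<bullet> u)
        - 2 * (u \<bullet> v) * (v \<bullet> (M *v u))) / ((u \<bullet> u) * (v \<bullet> v))"
      using pos by (simp add: field_simps)
    finally show ?thesis
      using mult_pos_pos[OF pos] by (simp add: zero_le_divide_iff)
  qed auto
  have sym: "u \<bullet> (M *v w) = w \<bullet> (M *v u)" for u w
  proof (cases "u = 0")
    case False
    \<comment> \<open>With \<open>v = u + t *\<^sub>R w\<close> the constant terms of
      \<open>two\<close> cancel, and the coefficient of \<open>t\<close> is the asymmetry of
      \<open>M\<close> scaled by \<open>u \<bullet> u\<close>.\<close>
    have "0 \<le> t * ((u \<bullet> u) * (u \<bullet> (M *v w) - w \<bullet> (M *v u))) + t\<^sup>2 * ((u \<bullet> (M *v u)) * (w \<bullet> w)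
        + (w \<bullet> (M *v w)) * (u \<bullet> u) - 2 * (u \<bullet> w) * (w \<bullet> (M *v u)))" for t
      using two[of u "u + t *\<^sub>R w"]
      by (simp add: matrix_vector_right_distrib matrix_vector_mult_scaleR inner_add_left inner_add_right
          inner_commute[of w u] power2_eq_square algebra_simps)
    from linear_coeff_eq_0[OF this] False show ?thesis by simp
  qed auto
  have "transpose M = M"
  proof -
    have "M $ i $ j = axis i 1 \<bullet> (M *v axis j 1)" for i j
      by (simp add: inner_axis' matrix_vector_mult_basis column_def)
    then show ?thesis by (simp add: transpose_def vec_eq_iff sym)
  qed
  ultimately show ?thesis by (simp add: positive_semidefinite_def)
qed

text \<open>The rows are unit vectors, which gives boundedness; the defining equation is continuous
  in the entries, which gives closedness.\<close>

lemma compact_orthogonal_matrices: "compact {Q :: real^'n::finite^'n. orthogonal_matrix Q}"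
  unfolding compact_eq_bounded_closed
proof
  have "norm Q \<le> (\<Sum>i\<in>(UNIV::'n set). 1)" if "orthogonal_matrix Q" for Q :: "real^'n^'n"
  proof -
    have "norm (Q $ i) = 1" for i
      using that by (simp add: orthogonal_matrix_orthonormal_rows row_def)
    then show ?thesis
      unfolding norm_vec_def[of Q] by (intro order_trans[OF L2_set_le_sum]) auto
  qed
  then show "bounded {Q :: real^'n^'n. orthogonal_matrix Q}"
    by (auto simp: bounded_iff)
  show "closed {Q :: real^'n^'n. orthogonal_matrix Q}"
    unfolding orthogonal_matrix matrix_matrix_mult_def transpose_def
    by (intro closed_Collect_eq continuous_intros)
qed

text \<open>If \<open>Q\<close> maximises the trace of \<open>T ** Q\<close>, then
  \<open>Q ** R\<close> is a competitor for every orthogonal \<open>R\<close>, so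
  \<open>T ** Q\<close> meets the trace criterion for positive semidefiniteness.\<close>

lemma polar_decomposition_exists:
  fixes T :: "real^'n::finite^'n"
  shows "\<exists>Q. orthogonal_matrix Q \<and> positive_semidefinite (T ** Q)"
proof -
  let ?O = "{Q :: real^'n^'n. orthogonal_matrix Q}"
  have "continuous_on ?O (\<lambda>Q. trace (T ** Q))"
    unfolding trace_def matrix_matrix_mult_def vec_lambda_beta by (intro continuous_intros)
  moreover have "?O \<noteq> {}" using orthogonal_matrix_id by blast
  ultimately obtain Q where Q: "orthogonal_matrix Q"
    and max: "\<And>R. orthogonal_matrix R \<Longrightarrow> trace (T ** R) \<le> trace (T ** Q)"
    using continuous_attains_sup[OF compact_orthogonal_matrices] by blast
  have "positive_semidefinite (T ** Q)"
    using max orthogonal_matrix_mul[OF Q]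
    by (intro positive_semidefinite_if_trace_max) (simp flip: matrix_mul_assoc)
  with Q show ?thesis by blast
qed

text \<open>As \<open>T ** Q\<close> is symmetric, its square is its product with its own transpose,
  where \<open>Q\<close> cancels. This \<open>Q\<close> becomes the matrix \<open>F\<close> of the
  theorem.\<close>

lemma principal_sqrt_mult_transpose:
  fixes T :: "real^'n::finite^'n"
  obtains Q where "orthogonal_matrix Q" "principal_sqrt (T ** transpose T) = T ** Q"
    "positive_semidefinite (T ** Q)"
proof -
  obtain Q where Q: "orthogonal_matrix Q" and psd: "positive_semidefinite (T ** Q)"
    using polar_decomposition_exists by blast
  have "(T ** Q) ** (T ** Q) = (T ** Q) ** transpose (T ** Q)"
    using psd by (simp add: positive_semidefinite_def)
  also have "\<dots> = T ** (Q ** transpose Q) ** transpose T"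
    by (simp add: matrix_transpose_mul matrix_mul_assoc)
  also have "\<dots> = T ** transpose T"
    using Q by (simp add: orthogonal_matrix_def)
  finally show ?thesis using that Q psd principal_sqrt_eqI[OF psd] by blast
qed

lemma orthogonal_matrix_inner:
  fixes Q :: "real^'n::finite^'n"
  assumes "orthogonal_matrix Q"
  shows "(Q *v x) \<bullet> (Q *v y) = x \<bullet> y"
proof -
  have "(Q *v x) \<bullet> (Q *v y) = ((transpose Q ** Q) *v x) \<bullet> y"
    by (simp only: inner_matrix_vector_transpose[of "Q *v x"] matrix_vector_mul_assoc)
  then show ?thesis using assms by (simp add: orthogonal_matrix)
qed

section \<open>The affine change of variables\<close>

lemma transpose_mult_diag:
  "(transpose S ** diag_matrix d) $ i $ j = S $ j $ i * d $ j"
  by (simp add: matrix_matrix_mult_def transpose_def diag_matrix_def if_distrib cong: if_cong)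

lemma matrix_inv_eqI:
  fixes A B :: "real^'n::finite^'n"
  assumes "A ** B = mat 1" "B ** A = mat 1"
  shows "matrix_inv A = B"
proof -
  have "A ** matrix_inv A = mat 1 \<and> matrix_inv A ** A = mat 1"
    unfolding matrix_inv_def using assms by (intro someI) blast
  then show ?thesis using assms by (metis matrix_mul_assoc matrix_mul_lid matrix_mul_rid)
qed

theorem theorem10:
  fixes f g \<xi> :: "real^'n \<Rightarrow> real"
    and y :: "real^'n"
    and T A :: "real^'n^'n"
    and k :: 'n  \<comment> \<open>plays the role of the index 1; the index type carries no order, so any \<open>k\<close> will do\<close>
  assumes n_ge_2: "CARD('n) \<ge> 2"
    and f_pos: "\<forall>x. f x > 0"
    and g: "g = (\<lambda>x. - ln (f x))"
    and \<xi>_C2: "Ck_near 2 0 \<xi>"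
    and \<xi>_grad: "gradient \<xi> 0 = axis k 1"
    and \<xi>_hess: "hessian \<xi> 0 = diag_matrix (\<chi> i. if i = k then 0 else 2 * pi)"
    and T_inv: "invertible T"
    and f_\<xi>: "\<forall>x. f (y + T *v x) / f y = exp (- \<xi> x)"
    and A: "A = (\<chi> i j. 1 / (2 * pi) * hessian g y $ i $ j
                        + partial_deriv i g y * partial_deriv j g y)"
  shows "positive_definite A \<and>
    (\<exists>F. orthogonal_matrix F
             \<and> F *v (principal_sqrt (matrix_inv A) *v gradient g y) = axis k 1
             \<and> T = principal_sqrt (matrix_inv A) ** transpose F) \<and>
    T *v axis k 1 = matrix_inv A *v gradient g y \<and>
    ((\<forall>x. \<xi> x = x $ k + pi * (\<Sum>i\<in>UNIV - {k}. (x $ i)\<^sup>2)) \<longrightarrow>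
         (\<forall>G. orthogonal_matrix G
              \<and> G *v (principal_sqrt (matrix_inv A) *v gradient g y) = axis k 1 \<longrightarrow>
              (\<forall>x. f (y + (principal_sqrt (matrix_inv A) ** transpose G) *v x) / f y
                   = exp (- (x $ k) - pi * (\<Sum>i\<in>UNIV - {k}. (x $ i)\<^sup>2)))))"
proof -
  obtain S where TS: "T ** S = mat 1" and ST: "S ** T = mat 1"
    using T_inv unfolding invertible_def by blast
  have ST_tr: "transpose T ** transpose S = mat 1" "transpose S ** transpose T = mat 1"
    using TS ST by (metis matrix_transpose_mul transpose_mat)+
  let ?v = "gradient g y" and ?P = "principal_sqrt (matrix_inv A)"

  \<comment> \<open>The hypothesis is used at \<open>x = S *v (z - y)\<close>, expanded to the shape
    \<open>b + S *v z\<close> of the affine chain rule.\<close>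
  have g_z: "g z = g y + \<xi> (- (S *v y) + S *v z)" for z
  proof -
    have "T *v (- (S *v y) + S *v z) = (T ** S) *v (z - y)"
      by (simp add: matrix_vector_mult_diff_distrib flip: matrix_vector_mul_assoc)
    then have "y + T *v (- (S *v y) + S *v z) = z" by (simp add: TS)
    then have "f z / f y = exp (- \<xi> (- (S *v y) + S *v z))"
      using f_\<xi>[rule_format, of "- (S *v y) + S *v z"] by simp
    then have "ln (f z / f y) = - \<xi> (- (S *v y) + S *v z)" by simp
    then have "ln (f z) - ln (f y) = - \<xi> (- (S *v y) + S *v z)"
      using f_pos[rule_format, of z] f_pos[rule_format, of y] by (simp add: ln_div)
    then show ?thesis by (simp add: g)
  qed
  have g_eq: "(\<lambda>z. g y + \<xi> (- (S *v y) + S *v z)) = g" by (rule ext, rule g_z[symmetric])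
  have C2: "Ck_near 2 (- (S *v y) + S *v y) \<xi>" using \<xi>_C2 by simp
  have grad_g: "?v = transpose S *v axis k 1"
    using gradient_affine[OF C2, of "g y"] unfolding g_eq by (simp add: \<xi>_grad)
  have hess_g: "hessian g y = transpose S ** diag_matrix (\<chi> i. if i = k then 0 else 2 * pi) ** S"
    using hessian_affine[OF C2, of "g y"] unfolding g_eq by (simp add: \<xi>_hess)

  have A_eq: "A = transpose S ** S"
  proof -
    have "A $ i $ j = (transpose S ** S) $ i $ j" for i j
    proof -
      have p: "partial_deriv l g y = S $ k $ l" for l
        using arg_cong[OF grad_g, of "\<lambda>v. v $ l"]
        by (simp add: gradient_def matrix_vector_mult_basis column_def transpose_def
            del: transpose_matrix_vector)
      \<comment> \<open>The Hessian contributes all terms of \<open>transpose S ** S\<close> except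
        \<open>l = k\<close>; the product of the gradient entries supplies that one.\<close>
      have "hessian g y $ i $ j = 2 * pi * (\<Sum>l\<in>UNIV. S $ l $ i * S $ l $ j * (if l = k then 0 else 1))"
        unfolding hess_g matrix_matrix_mult_def[of _ S] sum_distrib_left by (auto simp: transpose_mult_diag intro!: sum.cong)
      then have "A $ i $ j = (\<Sum>l\<in>UNIV. S $ l $ i * S $ l $ j * (if l = k then 0 else 1)) + S $ k $ i * S $ k $ j"
        by (simp add: A p)
      also have "S $ k $ i * S $ k $ j = (\<Sum>l\<in>UNIV. S $ l $ i * S $ l $ j * (if l = k then 1 else 0))"
        by (simp add: if_distrib cong: if_cong)
      finally show ?thesis
        by (simp add: matrix_matrix_mult_def transpose_def flip: sum.distrib distrib_left) (auto intro!: sum.cong)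
    qed
    then show ?thesis by (simp add: vec_eq_iff)
  qed

  have A_pd: "positive_definite A"
    unfolding positive_definite_def
  proof (intro conjI allI impI)
    show "transpose A = A" by (simp add: A_eq matrix_transpose_mul)
    fix x :: "real^'n" assume "x \<noteq> 0"
    then have "S *v x \<noteq> 0"
      using TS ST by (metis matrix_vector_mul_assoc matrix_vector_mul_lid matrix_vector_mult_0_right)
    moreover have "x \<bullet> (A *v x) = (S *v x) \<bullet> (S *v x)"
      by (simp add: A_eq inner_matrix_vector_transpose[of x "transpose S"] flip: matrix_vector_mul_assoc
          del: transpose_matrix_vector)
    ultimately show "0 < x \<bullet> (A *v x)" by simp
  qed

  have A_inv: "matrix_inv A = T ** transpose T"
  proof (rule matrix_inv_eqI)
    show "A ** (T ** transpose T) = mat 1"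
      unfolding A_eq by (metis ST ST_tr(2) matrix_mul_assoc matrix_mul_rid)
    show "T ** transpose T ** A = mat 1"
      unfolding A_eq by (metis TS ST_tr(1) matrix_mul_assoc matrix_mul_rid)
  qed

  obtain F where F: "orthogonal_matrix F" and P: "?P = T ** F" and psd: "positive_semidefinite (T ** F)"
    using principal_sqrt_mult_transpose[of T] A_inv by metis
  have T_eq: "T = ?P ** transpose F"
    using F by (simp add: P orthogonal_matrix_def flip: matrix_mul_assoc)
  have FPv: "F *v (?P *v ?v) = axis k 1"
  proof -
    \<comment> \<open>Symmetry of \<open>?P = T ** F\<close> turns \<open>F ** ?P\<close> into
      \<open>transpose T\<close>, the inverse of \<open>transpose S\<close>; and \<open>?v\<close>
      is \<open>transpose S *v axis k 1\<close>.\<close>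
    have "?P = transpose F ** transpose T"
      using psd by (metis P matrix_transpose_mul positive_semidefinite_def)
    then have "F ** ?P ** transpose S = mat 1"
      using F ST_tr(1) by (metis matrix_mul_assoc matrix_mul_rid orthogonal_matrix_def)
    then show ?thesis
      by (simp only: grad_g matrix_vector_mul_assoc matrix_mul_assoc) simp
  qed
  have Te: "T *v axis k 1 = matrix_inv A *v ?v"
  proof -
    have "T ** transpose T ** transpose S = T"
      by (metis ST_tr(1) matrix_mul_assoc matrix_mul_rid)
    then show ?thesis by (simp only: A_inv grad_g matrix_vector_mul_assoc)
  qed

  have "f (y + (?P ** transpose G) *v x) / f y = exp (- (x $ k) - pi * (\<Sum>i\<in>UNIV - {k}. (x $ i)\<^sup>2))"
    if \<xi>: "\<forall>x. \<xi> x = x $ k + pi * (\<Sum>i\<in>UNIV - {k}. (x $ i)\<^sup>2)"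
      and G: "orthogonal_matrix G" and GPv: "G *v (?P *v ?v) = axis k 1" for G x
  proof -
    \<comment> \<open>\<open>R\<close> is chosen so that \<open>?P ** transpose G = T ** R\<close>.
      Since \<open>F\<close> and \<open>G\<close> both send \<open>?P *v ?v\<close> to
      \<open>axis k 1\<close>, it fixes that vector.\<close>
    define R where "R = F ** transpose G"
    have R: "orthogonal_matrix R"
      unfolding R_def using F G by (simp add: orthogonal_matrix_mul)
    have "transpose G *v axis k 1 = ?P *v ?v"
      using G unfolding GPv[symmetric]
      by (simp only: matrix_vector_mul_assoc orthogonal_matrix_def matrix_mul_assoc) simp
    then have Re: "R *v axis k 1 = axis k 1"
      unfolding R_def using FPv by (simp only: matrix_vector_mul_assoc[symmetric])
    have "(R *v x) $ k = x $ k"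
      using orthogonal_matrix_inner[OF R, of x "axis k 1"] by (simp add: Re inner_axis)
    \<comment> \<open>Thus \<xi> depends only on coordinate \<open>k\<close> and the norm, both of
      which \<open>R\<close> preserves.\<close>
    moreover have "(\<Sum>i\<in>UNIV - {k}. (z $ i)\<^sup>2) = z \<bullet> z - (z $ k)\<^sup>2" for z :: "real^'n"
      by (simp add: inner_vec_def power2_eq_square sum_diff1)
    ultimately have "\<xi> (R *v x) = \<xi> x"
      using orthogonal_matrix_inner[OF R, of x x] by (simp add: \<xi>)
    moreover have "(?P ** transpose G) *v x = T *v (R *v x)"
      by (simp add: P R_def matrix_vector_mul_assoc matrix_mul_assoc)
    ultimately show ?thesis using f_\<xi> \<xi> by simp
  qed
  with A_pd F FPv T_eq Te show ?thesis by blast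
qed

end
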